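(* Let $C=\{q_1=0\}\subset\mathbb{R}^4$, and let $\pi\colon C\to\mathbb{R}^2$, $\pi(0,q_2,p_1,p_2)=(q_2,p_2)$. Order the extended-real-valued functions on $C$ and on $\mathbb{R}^2$ pointwise, and let $\pi^*f=f\circ\pi$. The operator $\mathrm{R}$ sending a function $g\colon C\to[-\infty,+\infty]$ to the function $\mathrm{R}(g)(b)=\inf_{\pi^{-1}(b)}g$ on $\mathbb{R}^2$ is the unique monotone map satisfying $$\pi^*f\le g\iff f\le\mathrm{R}(g)\qquad\text{for all } f\colon\mathbb{R}^2\to[-\infty,+\infty],\ g\colon C\to[-\infty,+\infty];$$ equivalently, $\mathrm{R}(g)$ is the largest function on $\mathbb{R}^2$ whose pullback by $\pi$ is dominated by $g$. In particular, for $H\in C^2(\mathbb{R}^4)$, the function $\mathcal{E}(q_2,p_2)=\inf_{p_1\in\mathbb{R}}H(0,q_2,p_1,p_2)$ equals $\mathrm{R}(H|_C)$.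
   Context: Coordinates on $\mathbb{R}^4$ are $(q_1,q_2,p_1,p_2)$. *)

theory Defs
  imports "HOL-Analysis.Analysis"
begin

text \<open>
  The components 1, 2, 3, 4 of a vector in \<open>real ^ 4\<close> are \<open>q\<^sub>1, q\<^sub>2, p\<^sub>1, p\<^sub>2\<close>, and the components
  1, 2 of a vector in \<open>real ^ 2\<close> are \<open>q\<^sub>2, p\<^sub>2\<close>.  The hyperplane \<open>C\<close> is a type, so that functions
  on \<open>C\<close> are functions in the sense of HOL, ordered pointwise by the library order.
\<close>

typedef hyperplane_C = "{x :: real ^ 4. x $ 1 = 0}"
  morphisms incl_C Abs_C
  by (rule exI[of _ 0]) simp

definition proj_C :: "hyperplane_C \<Rightarrow> real ^ 2" where
  "proj_C x = vector [incl_C x $ 2, incl_C x $ 4]"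

definition pullback_C :: "(real ^ 2 \<Rightarrow> ereal) \<Rightarrow> hyperplane_C \<Rightarrow> ereal" where
  "pullback_C f = f \<circ> proj_C"

definition R_op :: "(hyperplane_C \<Rightarrow> ereal) \<Rightarrow> real ^ 2 \<Rightarrow> ereal" where
  "R_op g b = (INF x \<in> proj_C -` {b}. g x)"

definition right_adjoint_of_pullback ::
    "((hyperplane_C \<Rightarrow> ereal) \<Rightarrow> real ^ 2 \<Rightarrow> ereal) \<Rightarrow> bool" where
  "right_adjoint_of_pullback S \<longleftrightarrow> (\<forall>f g. pullback_C f \<le> g \<longleftrightarrow> f \<le> S g)"

definition largest_dominated_pullback ::
    "(hyperplane_C \<Rightarrow> ereal) \<Rightarrow> (real ^ 2 \<Rightarrow> ereal) \<Rightarrow> bool" where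
  "largest_dominated_pullback g h \<longleftrightarrow>
     pullback_C h \<le> g \<and> (\<forall>f. pullback_C f \<le> g \<longrightarrow> f \<le> h)"

text \<open>Class \<open>C\<^sup>2\<close>: the Frechet derivatives of first and second order exist everywhere and the
  second one is continuous for the operator norm.\<close>

definition C2_fun :: "('a :: real_normed_vector \<Rightarrow> real) \<Rightarrow> bool" where
  "C2_fun H \<longleftrightarrow>
     (\<exists>(D1 :: 'a \<Rightarrow> 'a \<Rightarrow>\<^sub>L real) (D2 :: 'a \<Rightarrow> 'a \<Rightarrow>\<^sub>L 'a \<Rightarrow>\<^sub>L real).
        (\<forall>x. (H has_derivative blinfun_apply (D1 x)) (at x)) \<and>
        (\<forall>x. (D1 has_derivative blinfun_apply (D2 x)) (at x)) \<and>
        continuous_on UNIV D2)"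

end

theory Submission
  imports Defs
begin

text \<open>The inequality between \<open>pullback_C f\<close> and \<open>g\<close> compares
  \<open>f (proj_C x)\<close> with \<open>g x\<close> at each point \<open>x\<close>. Sorted by
  fibres of \<open>proj_C\<close>, it says that each \<open>f b\<close> is a lower bound of
  \<open>g\<close> on the fibre over \<open>b\<close>, that is, \<open>f b\<close> is at most the
  infimum there: this is \<open>right_adjoint_R_op\<close>. Any right adjoint picks the largest
  function with dominated pullback (\<open>right_adjoint_largest\<close>), and a largest element is
  unique, so both characterisations single out \<open>R_op\<close>. The formula for the energy holds
  because the fibres are lines parametrised by the third coordinate
  (\<open>proj_C_fiber\<close>).\<close>

lemma vector_4:
  fixes a b c d :: "'a::zero"
  shows "(vector [a, b, c, d] :: 'a ^ 4) $ 1 = a"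
    and "(vector [a, b, c, d] :: 'a ^ 4) $ 2 = b"
    and "(vector [a, b, c, d] :: 'a ^ 4) $ 3 = c"
    and "(vector [a, b, c, d] :: 'a ^ 4) $ 4 = d"
  by (simp_all add: vector_def)

lemma incl_C_Abs_C_vector [simp]:
  "incl_C (Abs_C (vector [0, u, v, w])) = vector [0, u, v, w]"
  by (rule Abs_C_inverse) (simp add: vector_4)

lemma proj_C_Abs_C_vector [simp]:
  "proj_C (Abs_C (vector [0, u, v, w])) = vector [u, w]"
  by (simp add: proj_C_def vector_4)

text \<open>Only the third coordinate is free: the first vanishes on the hyperplane, and
  \<open>b\<close> fixes the second and fourth.\<close>

lemma proj_C_fiber:
  "proj_C -` {b} = range (\<lambda>p. Abs_C (vector [0, b $ 1, p, b $ 2]))"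
proof (intro equalityI subsetI)
  fix x assume "x \<in> proj_C -` {b}"
  then have b: "b = vector [incl_C x $ 2, incl_C x $ 4]"
    by (simp add: proj_C_def)
  \<comment> \<open>The fact \<open>incl_C[of x]\<close> supplies the vanishing first
    coordinate.\<close>
  have "incl_C x = vector [0, b $ 1, incl_C x $ 3, b $ 2]"
    using incl_C[of x] by (simp add: b vec_eq_iff forall_4 vector_4)
  then have "x = Abs_C (vector [0, b $ 1, incl_C x $ 3, b $ 2])"
    by (metis incl_C_inverse)
  then show "x \<in> range (\<lambda>p. Abs_C (vector [0, b $ 1, p, b $ 2]))"
    by blast
next
  fix x assume "x \<in> range (\<lambda>p. Abs_C (vector [0, b $ 1, p, b $ 2]))"
  then show "x \<in> proj_C -` {b}"
    by (auto simp: vec_eq_iff forall_2)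
qed

lemma right_adjoint_R_op: "right_adjoint_of_pullback R_op"
  by (auto simp: right_adjoint_of_pullback_def pullback_C_def R_op_def le_fun_def le_INF_iff)

text \<open>If \<open>g \<le> g'\<close>, the adjunction at \<open>S g \<le> S g\<close> gives
  \<open>pullback_C (S g) \<le> g \<le> g'\<close>; the adjunction for \<open>g'\<close> then gives
  \<open>S g \<le> S g'\<close>.\<close>

lemma mono_right_adjoint:
  assumes "right_adjoint_of_pullback S"
  shows "mono S"
  using assms unfolding right_adjoint_of_pullback_def by (meson monoI order.refl order.trans)

text \<open>Taking \<open>f = S g\<close> in the adjunction gives domination; its forward direction
  gives maximality.\<close>

lemma right_adjoint_largest:
  assumes "right_adjoint_of_pullback S"
  shows "largest_dominated_pullback g (S g)"
  using assms unfolding right_adjoint_of_pullback_def largest_dominated_pullback_def by blast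

lemma largest_dominated_pullback_unique:
  assumes "largest_dominated_pullback g h" "largest_dominated_pullback g h'"
  shows "h = h'"
  using assms unfolding largest_dominated_pullback_def by (meson antisym)

lemma largest_imp_eq_R_op:
  assumes "\<forall>g. largest_dominated_pullback g (S g)"
  shows "S = R_op"
  using assms largest_dominated_pullback_unique right_adjoint_largest[OF right_adjoint_R_op]
  by (intro ext[of S]) metis

lemma R_op_eq_INF_line:
  "R_op g b = (INF p. g (Abs_C (vector [0, b $ 1, p, b $ 2])))"
  by (simp add: R_op_def proj_C_fiber image_image)

theorem proposition3p1:
  shows "mono R_op \<and> right_adjoint_of_pullback R_op
    \<and> (\<forall>S. mono S \<and> right_adjoint_of_pullback S \<longrightarrow> S = R_op)
    \<and> (\<forall>g. largest_dominated_pullback g (R_op g))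
    \<and> (\<forall>S. (mono S \<and> right_adjoint_of_pullback S) \<longleftrightarrow> (\<forall>g. largest_dominated_pullback g (S g)))
    \<and> (\<forall>H :: real ^ 4 \<Rightarrow> real. C2_fun H \<longrightarrow>
         (\<lambda>b :: real ^ 2. INF p\<^sub>1 :: real. ereal (H (vector [0, b $ 1, p\<^sub>1, b $ 2])))
           = R_op (\<lambda>x. ereal (H (incl_C x))))"
proof (intro conjI allI impI)
  show "mono R_op"
    by (rule mono_right_adjoint[OF right_adjoint_R_op])
  show "right_adjoint_of_pullback R_op"
    by (rule right_adjoint_R_op)
  show "S = R_op" if "mono S \<and> right_adjoint_of_pullback S" for S
    using that by (intro largest_imp_eq_R_op allI right_adjoint_largest) simp
  show "largest_dominated_pullback g (R_op g)" for g
    by (rule right_adjoint_largest[OF right_adjoint_R_op])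
  \<comment> \<open>From right to left, maximality forces \<open>S = R_op\<close>, which is already
    known to be a monotone right adjoint.\<close>
  show "(mono S \<and> right_adjoint_of_pullback S) \<longleftrightarrow> (\<forall>g. largest_dominated_pullback g (S g))" for S
    using largest_imp_eq_R_op mono_right_adjoint right_adjoint_R_op right_adjoint_largest
    by metis
  show "(\<lambda>b. INF p\<^sub>1. ereal (H (vector [0, b $ 1, p\<^sub>1, b $ 2]))) = R_op (\<lambda>x. ereal (H (incl_C x)))"
    for H :: "real ^ 4 \<Rightarrow> real"
    by (simp add: R_op_eq_INF_line fun_eq_iff)
qed

end
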